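(* Let $\boldsymbol\alpha=(\alpha_1,\dots,\alpha_n)\in\mathbb{R}^n$ with $\alpha_j\notin\pi\mathbb{Z}$ for $j=1,\dots,n$, let $1\le k\le n$, and let $f\in L^1(\mathbb{R}^n)$. If $e_{\boldsymbol\alpha}f$ is absolutely continuous on $\mathbb{R}^n$ with respect to the $k$th variable, then $$\mathcal{F}_{\boldsymbol\alpha}\left(e_{-\boldsymbol\alpha}(\boldsymbol y)\frac{\partial[e_{\boldsymbol\alpha}(\boldsymbol y)f(\boldsymbol y)]}{\partial y_k}\right)(\boldsymbol x)=i x_k\csc\alpha_k\,\mathcal{F}_{\boldsymbol\alpha}(f)(\boldsymbol x),$$ where $\boldsymbol x=(x_1,\dots,x_n)$.
   Context: For $\boldsymbol\alpha\in\mathbb{R}^n$ with all $\alpha_k\notin\pi\mathbb{Z}$, the chirp is $e_{\boldsymbol\alpha}(\boldsymbol x)=\exp\big(\tfrac{i}{2}\sum_{k=1}^n x_k^2\cot\alpha_k\big)$, so $e_{-\boldsymbol\alpha}=1/e_{\boldsymbol\alpha}$. The (multidimensional) fractional Fourier transform of order $\boldsymbol\alpha$ of $f\in L^1(\mathbb{R}^n)$ is $$\mathcal{F}_{\boldsymbol\alpha}(f)(\boldsymbol u)=\frac{c(\boldsymbol\alpha)}{(\sqrt{2\pi})^n}\,e_{\boldsymbol\alpha}(\boldsymbol u)\int_{\mathbb{R}^n}f(\boldsymbol x)e_{\boldsymbol\alpha}(\boldsymbol x)e^{-i\sum_{k=1}^n x_ku_k\csc\alpha_k}\,d\boldsymbol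 x,\qquad c(\boldsymbol\alpha)=\prod_{k=1}^n\sqrt{1-i\cot\alpha_k}.$$
   Formalization: The formal statement additionally assumes that e_{-α}(y) ∂[e_α(y) f(y)]/∂y_k belongs to L^1(R^n), without which the left-hand fractional Fourier transform is undefined; this does not follow from the other hypotheses. *)

theory Defs
  imports "HOL-Analysis.Analysis"
begin

definition chirp :: "real ^ 'n \<Rightarrow> real ^ 'n \<Rightarrow> complex" where
  "chirp \<alpha> x = exp (\<i> / 2 * of_real (\<Sum>k\<in>UNIV. (x $ k)\<^sup>2 * cot (\<alpha> $ k)))"

lemma chirp_uminus: "chirp (- \<alpha>) x = 1 / chirp \<alpha> x"
  by (simp add: chirp_def cot_def sum_negf exp_minus field_simps)

definition csc :: "real \<Rightarrow> real" where
  "csc t = 1 / sin t"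

text \<open>The square root is the principal branch; its argument has real part 1.\<close>

definition frft_const :: "real ^ 'n \<Rightarrow> complex" where
  "frft_const \<alpha> = (\<Prod>k\<in>UNIV. csqrt (1 - \<i> * of_real (cot (\<alpha> $ k))))"

text \<open>Meaningful only for Lebesgue integrable \<open>f\<close>: the Bochner integral of a
  non-integrable function is 0 by convention.\<close>

definition frft :: "real ^ 'n \<Rightarrow> (real ^ 'n \<Rightarrow> complex) \<Rightarrow> real ^ 'n \<Rightarrow> complex" where
  "frft \<alpha> f u =
     frft_const \<alpha> / of_real (sqrt (2 * pi)) ^ CARD('n) * chirp \<alpha> u *
     (LINT x|lebesgue. f x * chirp \<alpha> x *
        exp (- \<i> * of_real (\<Sum>k\<in>UNIV. x $ k * u $ k * csc (\<alpha> $ k))))"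

definition replace_coord :: "real ^ 'n \<Rightarrow> 'n \<Rightarrow> real \<Rightarrow> real ^ 'n" where
  "replace_coord y k t = (\<chi> j. if j = k then t else y $ j)"

text \<open>Where the one-variable derivative does not exist, the value is unspecified.\<close>

definition partial_derivative ::
    "'n \<Rightarrow> (real ^ 'n \<Rightarrow> complex) \<Rightarrow> real ^ 'n \<Rightarrow> complex" where
  "partial_derivative k g y =
     vector_derivative (\<lambda>t. g (replace_coord y k t)) (at (y $ k))"

text \<open>The usual \<open>\<epsilon>\<close>-\<open>\<delta>\<close> definition on an interval \<open>I\<close> (possibly unbounded); a pair
  \<open>(a, b)\<close> in \<open>D\<close> stands for the interval from \<open>a\<close> to \<open>b\<close>, and the open intervals
  are pairwise disjoint.\<close>

definition abs_continuous_on :: "real set \<Rightarrow> (real \<Rightarrow> complex) \<Rightarrow> bool" where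
  "abs_continuous_on I g \<longleftrightarrow>
     (\<forall>\<epsilon>>0. \<exists>\<delta>>0. \<forall>D :: (real \<times> real) set.
        finite D \<longrightarrow>
        (\<forall>(a, b)\<in>D. a < b \<and> {a..b} \<subseteq> I) \<longrightarrow>
        disjoint_family_on (\<lambda>(a, b). {a<..<b}) D \<longrightarrow>
        (\<Sum>(a, b)\<in>D. b - a) < \<delta> \<longrightarrow>
        (\<Sum>(a, b)\<in>D. norm (g b - g a)) < \<epsilon>)"

definition abs_continuous_in_coord :: "'n \<Rightarrow> (real ^ 'n \<Rightarrow> complex) \<Rightarrow> bool" where
  "abs_continuous_in_coord k g \<longleftrightarrow>
     (\<forall>y. abs_continuous_on UNIV (\<lambda>t. g (replace_coord y k t)))"

end

theory Submission
  imports Defs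
begin

text \<open>
  Multiplication by \<open>chirp \<alpha>\<close> turns the fractional Fourier transform at \<open>x\<close> into an
  ordinary Fourier integral: with \<open>g = chirp \<alpha> \<cdot> f\<close> and \<open>\<xi>\<^sub>j = x\<^sub>j csc \<alpha>\<^sub>j\<close>, both sides of the
  theorem have the same factor in front, and what remains is
  \<open>\<integral> \<partial>\<^sub>k g(y) exp (- \<i> y \<bullet> \<xi>) dy = \<i> \<xi>\<^sub>k \<integral> g(y) exp (- \<i> y \<bullet> \<xi>) dy\<close>.
  Equivalently, the \<open>k\<close>th partial derivative of \<open>h(y) = g(y) exp (- \<i> y \<bullet> \<xi>)\<close> has integral 0.

  Along every line in direction \<open>e\<^sub>k\<close> the function \<open>h\<close> is locally absolutely continuous, hence
  \<open>h(y + e\<^sub>k) - h(y)\<close> is the integral of \<open>\<partial>\<^sub>k h(y + s e\<^sub>k)\<close> over \<open>0 \<le> s \<le> 1\<close>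
  (\<open>modulated_partial_derivative_has_integral\<close>).  Integrating this identity over all \<open>y\<close> and using
  Fubini's theorem and translation invariance on both sides gives \<open>0 = \<integral> \<partial>\<^sub>k h\<close>
  (\<open>integral_directional_derivative_eq_0\<close>).

  The work lies in the one-dimensional theory behind the identity on lines: an absolutely
  continuous function is differentiable almost everywhere and is recovered from its derivative
  by integration.  For monotone functions, differentiability follows from Vitali's covering
  theorem, applied once to intervals where the function is flat and once to intervals where
  it is steep (\<open>negligible_flat_and_steep\<close>, \<open>mono_differentiable_ae\<close>); an absolutely continuous
  function is locally a difference of monotone ones (\<open>abs_continuous_differentiable_ae\<close>).  The
  fundamental theorem (\<open>abs_continuous_FTC\<close>) then comes from the gauge integral, whose gauge can
  treat the null set of points without derivative separately.
\<close>

section \<open>Vitali covers and monotone functions\<close>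

text \<open>
  Closed intervals are the closed balls of the line, so this is Vitali's covering
  theorem; passing to open intervals costs only the countably many endpoints.
\<close>

lemma Vitali_covering_intervals:
  fixes S U :: "real set"
  assumes U: "open U" "S \<subseteq> U"
    and cover: "\<And>x d. x \<in> S \<Longrightarrow> 0 < d \<Longrightarrow> \<exists>a b. a < b \<and> a \<le> x \<and> x \<le> b \<and> b - a < d \<and> P a b"
  obtains C where "countable C"
    "\<And>a b. (a, b) \<in> C \<Longrightarrow> a < b \<and> {a..b} \<subseteq> U \<and> P a b"
    "disjoint_family_on (\<lambda>(a, b). {a..b}) C"
    "negligible (S - (\<Union>(a, b)\<in>C. {a<..<b}))"
proof -
  define K where "K = {(a, b). a < b \<and> {a..b} \<subseteq> U \<and> P a b}"
  define m where "m = (\<lambda>(a::real, b::real). (a + b) / 2)"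
  define r where "r = (\<lambda>(a::real, b::real). (b - a) / 2)"
  have ball: "cball (m i) (r i) = {fst i..snd i}" for i
    by (auto simp: m_def r_def cball_eq_atLeastAtMost field_simps split: prod.split)
  have r: "0 < r i" if "i \<in> K" for i
    using that by (auto simp: K_def r_def)
  have "\<exists>i. i \<in> K \<and> x \<in> cball (m i) (r i) \<and> r i < d" if x: "x \<in> S" and d: "0 < d" for x d
  proof -
    obtain e where e: "0 < e" "cball x e \<subseteq> U"
      using U x open_contains_cball by (metis subsetD)
    obtain a b where ab: "a < b" "a \<le> x" "x \<le> b" "b - a < min d e" "P a b"
      using cover[OF x, of "min d e"] d e by auto
    have "{a..b} \<subseteq> cball x e"
      using ab by (auto simp: cball_eq_atLeastAtMost)
    then have "(a, b) \<in> K"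
      using ab e by (auto simp: K_def)
    then show ?thesis
      using ab by (intro exI[of _ "(a, b)"]) (auto simp: ball, auto simp: r_def)
  qed
  from Vitali_covering_theorem_cballs[of K r S m, OF r this]
  obtain C where C: "countable C" "C \<subseteq> K"
    "pairwise (\<lambda>i j. disjnt (cball (m i) (r i)) (cball (m j) (r j))) C"
    "negligible (S - (\<Union>i\<in>C. cball (m i) (r i)))"
    by blast
  have "negligible (fst ` C \<union> snd ` C)"
    unfolding negligible_iff_null_sets using C
    by (intro null_sets_completionI countable_imp_null_set_lborel) auto
  then have "negligible ((S - (\<Union>i\<in>C. cball (m i) (r i))) \<union> (fst ` C \<union> snd ` C))"
    using C by (metis negligible_Un)
  moreover have "S - (\<Union>(a, b)\<in>C. {a<..<b}) \<subseteq> (S - (\<Union>i\<in>C. cball (m i) (r i))) \<union> (fst ` C \<union> snd ` C)"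
    unfolding ball by (force simp: image_iff)
  ultimately have "negligible (S - (\<Union>(a, b)\<in>C. {a<..<b}))"
    by (rule negligible_subset)
  moreover have "disjoint_family_on (\<lambda>(a, b). {a..b}) C"
    using pairwiseD[OF C(3)]
    by (simp add: disjoint_family_on_def ball disjnt_def case_prod_beta)
  ultimately show thesis
    using C by (intro that[of C]) (auto simp: K_def)
qed

lemma emeasure_disjoint_intervals:
  fixes u v :: "'i \<Rightarrow> real"
  assumes "countable C" "disjoint_family_on (\<lambda>i. {u i<..<v i}) C"
    and "\<And>i. i \<in> C \<Longrightarrow> u i \<le> v i"
  shows "emeasure lborel (\<Union>i\<in>C. {u i<..<v i}) = (\<integral>\<^sup>+i. ennreal (v i - u i) \<partial>count_space C)"
  using assms by (subst emeasure_UN_countable) (auto intro!: nn_integral_cong)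

text \<open>
  Images under \<open>F\<close> turn sums of increments of \<open>F\<close> over disjoint intervals into
  Lebesgue measures of disjoint unions, so that such sums can be compared by
  inclusion of sets.  An image interval may be empty.
\<close>

lemma disjoint_mono_intervals:
  fixes F :: "real \<Rightarrow> real"
  assumes F: "mono F" and C: "disjoint_family_on (\<lambda>(a, b). {a..b}) C"
    and ne: "\<And>a b. (a, b) \<in> C \<Longrightarrow> a < b"
  shows "disjoint_family_on (\<lambda>i. {F (fst i)<..<F (snd i)}) C"
  unfolding disjoint_family_on_def
proof (intro ballI impI)
  fix i j assume ij: "i \<in> C" "j \<in> C" "i \<noteq> j"
  have "{fst i..snd i} \<inter> {fst j..snd j} = {}"
    using disjoint_family_onD[OF C ij] by (simp add: case_prod_beta)
  moreover have "fst i < snd i" "fst j < snd j"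
    using ne ij by (metis prod.collapse)+
  ultimately have "snd i < fst j \<or> snd j < fst i"
    by auto
  then have "F (snd i) \<le> F (fst j) \<or> F (snd j) \<le> F (fst i)"
    using monoD[OF F] by (meson less_imp_le)
  then show "{F (fst i)<..<F (snd i)} \<inter> {F (fst j)<..<F (snd j)} = {}"
    by auto
qed

text \<open>
  Vitali covers miss a null set, so the covers that they provide satisfy only this
  weaker form of the usual criterion for null sets.
\<close>

lemma negligible_if_essentially_covered:
  fixes S :: "real set"
  assumes "\<And>e::real. 0 < e \<Longrightarrow> \<exists>V. open V \<and> negligible (S - V) \<and> emeasure lborel V \<le> ennreal e"
  shows "negligible S"
proof -
  have "\<forall>n::nat. \<exists>V. open V \<and> negligible (S - V) \<and> emeasure lborel V \<le> ennreal (1 / Suc n)"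
    using assms by auto
  then obtain V where V: "\<And>n::nat. open (V n)" "\<And>n. negligible (S - V n)"
    "\<And>n. emeasure lborel (V n) \<le> ennreal (1 / Suc n)"
    by metis
  have "emeasure lborel (\<Inter>n. V n) \<le> ennreal e" if "0 < e" for e :: real
  proof -
    obtain n where n: "1 / Suc n < e"
      using nat_approx_posE[OF \<open>0 < e\<close>] by auto
    have "emeasure lborel (\<Inter>n. V n) \<le> emeasure lborel (V n)"
      using V by (intro emeasure_mono) auto
    also have "\<dots> \<le> ennreal e"
      using V(3)[of n] n by (meson ennreal_leI less_imp_le order_trans)
    finally show ?thesis .
  qed
  then have "emeasure lborel (\<Inter>n. V n) = 0"
    by (metis ennreal_le_epsilon add_0 le_zero_eq)
  moreover have "(\<Inter>n. V n) \<in> sets lborel"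
    using V by auto
  ultimately have "negligible (\<Inter>n. V n)"
    unfolding negligible_iff_null_sets by (intro null_sets_completionI) auto
  moreover have "negligible (\<Union>n. S - V n)"
    using V by (intro negligible_countable_Union) auto
  ultimately have "negligible ((\<Inter>n. V n) \<union> (\<Union>n. S - V n))"
    by (rule negligible_Un)
  then show ?thesis
    by (rule negligible_subset) auto
qed

text \<open>
  \<open>steep_at F q x\<close> and \<open>flat_at F p x\<close> say that difference quotients of \<open>F\<close> over
  arbitrarily short intervals containing \<open>x\<close> exceed \<open>q\<close>, respectively fall below \<open>p\<close>.
  Such an interval may have \<open>x\<close> in its interior, but its quotient is then a mean of the
  quotients over its parts on either side of \<open>x\<close>.  So, up to the case of equality, the conditions
  say that the upper derivative exceeds \<open>q\<close> and that the lower derivative is below \<open>p\<close>.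
\<close>

definition steep_at :: "(real \<Rightarrow> real) \<Rightarrow> real \<Rightarrow> real \<Rightarrow> bool" where
  "steep_at F q x \<longleftrightarrow>
     (\<forall>d>0. \<exists>a b. a < b \<and> a \<le> x \<and> x \<le> b \<and> b - a < d \<and> q * (b - a) < F b - F a)"

definition flat_at :: "(real \<Rightarrow> real) \<Rightarrow> real \<Rightarrow> real \<Rightarrow> bool" where
  "flat_at F p x \<longleftrightarrow>
     (\<forall>d>0. \<exists>a b. a < b \<and> a \<le> x \<and> x \<le> b \<and> b - a < d \<and> F b - F a < p * (b - a))"

text \<open>
  Steep points occupy little room: a Vitali cover of \<open>S\<close> by disjoint intervals on
  which \<open>F\<close> grows faster than \<open>q\<close> uses up \<open>q\<close> times its length in growth, and the
  growth available is that of \<open>F\<close> over the intervals \<open>W\<close> containing \<open>S\<close>.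
\<close>

lemma steep_cover:
  fixes F :: "real \<Rightarrow> real"
  assumes F: "mono F" and q: "0 < q" and W: "disjoint_family_on (\<lambda>(c, d). {c..d}) W" "countable W"
    and WF: "\<And>c d. (c, d) \<in> W \<Longrightarrow> c < d"
    and S: "S \<subseteq> (\<Union>(c, d)\<in>W. {c<..<d})" "\<And>x. x \<in> S \<Longrightarrow> steep_at F q x"
  obtains V where "open V" "negligible (S - V)"
    "ennreal q * emeasure lborel V \<le> (\<integral>\<^sup>+i. ennreal (F (snd i) - F (fst i)) \<partial>count_space W)"
proof -
  define U where "U = (\<Union>(c, d)\<in>W. {c<..<d})"
  have "open U"
    unfolding U_def by auto
  \<comment> \<open>Each covering interval has to lie inside a single member of \<open>W\<close>, otherwise its
    increment could not be charged to the increments over \<open>W\<close>.\<close>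
  define P where "P = (\<lambda>a b. q * (b - a) < F b - F a \<and> (\<exists>(c, d)\<in>W. {a..b} \<subseteq> {c<..<d}))"
  have cover: "\<exists>a b. a < b \<and> a \<le> x \<and> x \<le> b \<and> b - a < d \<and> P a b" if x: "x \<in> S" "0 < d" for x d
  proof -
    obtain u v where uv: "(u, v) \<in> W" "u < x" "x < v"
      using S x by fastforce
    obtain a b where "a < b" "a \<le> x" "x \<le> b" "b - a < min d (min (x - u) (v - x))" "q * (b - a) < F b - F a"
      using S(2)[OF x(1), unfolded steep_at_def, rule_format, of "min d (min (x - u) (v - x))"] x uv by auto
    then show ?thesis
      using uv by (intro exI[of _ a] exI[of _ b]) (force simp: P_def)
  qed
  obtain C where C: "countable C" "\<And>a b. (a, b) \<in> C \<Longrightarrow> a < b \<and> {a..b} \<subseteq> U \<and> P a b"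
    "disjoint_family_on (\<lambda>(a, b). {a..b}) C" "negligible (S - (\<Union>(a, b)\<in>C. {a<..<b}))"
    using Vitali_covering_intervals[OF \<open>open U\<close> S(1)[folded U_def] cover] by blast
  define V where "V = (\<Union>(a, b)\<in>C. {a<..<b})"
  have V': "V = (\<Union>i\<in>C. {fst i<..<snd i})"
    by (auto simp: V_def split: prod.splits)
  have disj: "disjoint_family_on (\<lambda>i. {F (fst i)<..<F (snd i)}) C" "disjoint_family_on (\<lambda>i. {fst i<..<snd i}) C"
    "disjoint_family_on (\<lambda>i. {F (fst i)<..<F (snd i)}) W"
    using disjoint_mono_intervals[OF F C(3)] disjoint_mono_intervals[OF _ C(3), of "\<lambda>x. x"]
      disjoint_mono_intervals[OF F W(1)] C WF
    by (auto simp: mono_def)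
  have "ennreal q * emeasure lborel V = (\<integral>\<^sup>+i. ennreal q * ennreal (snd i - fst i) \<partial>count_space C)"
    unfolding V' using C disj by (subst emeasure_disjoint_intervals) (auto simp: nn_integral_cmult less_imp_le)
  also have "\<dots> \<le> (\<integral>\<^sup>+i. ennreal (F (snd i) - F (fst i)) \<partial>count_space C)"
    using C(2) q by (intro nn_integral_mono)
      (auto simp flip: ennreal_mult' simp: P_def less_imp_le split: prod.splits intro!: ennreal_leI)
  also have "\<dots> = emeasure lborel (\<Union>i\<in>C. {F (fst i)<..<F (snd i)})"
    using C disj monoD[OF F] by (subst emeasure_disjoint_intervals) (auto simp: less_imp_le)
  also have "\<dots> \<le> emeasure lborel (\<Union>i\<in>W. {F (fst i)<..<F (snd i)})"
  proof (rule emeasure_mono)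
    show "(\<Union>i\<in>C. {F (fst i)<..<F (snd i)}) \<subseteq> (\<Union>i\<in>W. {F (fst i)<..<F (snd i)})"
    proof safe
      fix a b y assume ab: "(a, b) \<in> C" and y: "y \<in> {F (fst (a, b))<..<F (snd (a, b))}"
      obtain c d where cd: "(c, d) \<in> W" "{a..b} \<subseteq> {c<..<d}" "a < b"
        using C(2)[OF ab] by (auto simp: P_def)
      have "a \<in> {c<..<d}" "b \<in> {c<..<d}"
        using cd atLeastAtMost_iff[of a a b] atLeastAtMost_iff[of b a b] by (meson less_imp_le order_refl subsetD)+
      then have "F c \<le> F a" "F b \<le> F d"
        using monoD[OF F] by auto
      then show "y \<in> (\<Union>i\<in>W. {F (fst i)<..<F (snd i)})"
        using cd y by (intro UN_I[of "(c, d)"]) auto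
    qed
  qed (use W in auto)
  also have "\<dots> = (\<integral>\<^sup>+i. ennreal (F (snd i) - F (fst i)) \<partial>count_space W)"
    using W disj monoD[OF F] WF by (subst emeasure_disjoint_intervals) (auto simp: less_imp_le)
  finally show thesis
    using C by (intro that[of V]) (auto simp: V_def)
qed

text \<open>
  On flat intervals the growth of \<open>F\<close> is at most \<open>p\<close> times the length, and the lengths of
  disjoint intervals in \<open>U\<close> add up to at most the measure of \<open>U\<close>.
\<close>

lemma flat_cover:
  fixes F :: "real \<Rightarrow> real"
  assumes p: "0 < p" and U: "open U" "S \<subseteq> U" and S: "\<And>x. x \<in> S \<Longrightarrow> flat_at F p x"
  obtains C where "countable C" "\<And>a b. (a, b) \<in> C \<Longrightarrow> a < b \<and> {a..b} \<subseteq> U"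
    "disjoint_family_on (\<lambda>(a, b). {a..b}) C" "negligible (S - (\<Union>(a, b)\<in>C. {a<..<b}))"
    "(\<integral>\<^sup>+i. ennreal (F (snd i) - F (fst i)) \<partial>count_space C) \<le> ennreal p * emeasure lborel U"
proof -
  obtain C where C: "countable C" "\<And>a b. (a, b) \<in> C \<Longrightarrow> a < b \<and> {a..b} \<subseteq> U \<and> F b - F a < p * (b - a)"
    "disjoint_family_on (\<lambda>(a, b). {a..b}) C" "negligible (S - (\<Union>(a, b)\<in>C. {a<..<b}))"
    using Vitali_covering_intervals[OF U, of "\<lambda>a b. F b - F a < p * (b - a)"] S
    unfolding flat_at_def by (smt (verit, del_insts))
  have "(\<integral>\<^sup>+i. ennreal (F (snd i) - F (fst i)) \<partial>count_space C) \<le>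
        (\<integral>\<^sup>+i. ennreal p * ennreal (snd i - fst i) \<partial>count_space C)"
    using C(2) p by (intro nn_integral_mono)
      (auto simp flip: ennreal_mult' simp: less_imp_le split: prod.splits intro!: ennreal_leI)
  also have "\<dots> = ennreal p * emeasure lborel (\<Union>i\<in>C. {fst i<..<snd i})"
    using C disjoint_mono_intervals[OF _ C(3), of "\<lambda>x. x"]
    by (subst emeasure_disjoint_intervals) (auto simp: nn_integral_cmult less_imp_le mono_def)
  also have "\<dots> \<le> ennreal p * emeasure lborel U"
    using C(2) U by (intro mult_left_mono emeasure_mono) fastforce+
  finally show thesis
    using C by (intro that[of C]) auto
qed

text \<open>
  A monotone function is nowhere flat for \<open>p \<le> 0\<close>, so let \<open>p > 0\<close>.
  An open set \<open>U\<close> containing almost all of these points can be replaced by a smaller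
  one: cover the points by flat intervals in \<open>U\<close>, over which \<open>F\<close> grows by at most
  \<open>p\<close> times the measure of \<open>U\<close>, and these in turn by steep intervals, whose total
  length is at most \<open>1 / q\<close> times that growth.  So the measure shrinks by the factor
  \<open>p / q < 1\<close>, and iteration makes it arbitrarily small.  Open sets that cover up to
  a null set take the place of the outer measure of the set of points.
\<close>

lemma negligible_flat_and_steep:
  assumes F: "mono F" and pq: "p < q"
  shows "negligible {x. flat_at F p x \<and> steep_at F q x}"
proof (cases "0 < p")
  case False
  have "\<not> flat_at F p x" for x
  proof
    assume "flat_at F p x"
    then obtain a b where "a < b" "F b - F a < p * (b - a)"
      unfolding flat_at_def using zero_less_one by blast
    moreover have "p * (b - a) \<le> 0"
      using False \<open>a < b\<close> by (simp add: mult_nonpos_nonneg)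
    ultimately show False
      using monoD[OF F, of a b] by auto
  qed
  then show ?thesis by simp
next
  case p: True
  then have q: "0 < q" using pq by simp
  have "negligible {x\<in>{-n<..<n}. flat_at F p x \<and> steep_at F q x}" (is "negligible ?S") if n: "0 < n" for n :: real
  proof (rule negligible_if_essentially_covered)
    have shrink: "\<exists>V. open V \<and> negligible (?S - V) \<and> emeasure lborel V \<le> ennreal ((p / q) * m)"
      if U: "open U" "negligible (?S - U)" "emeasure lborel U \<le> ennreal m" for U m
    proof -
      have flat: "?S \<inter> U \<subseteq> U" "\<And>x. x \<in> ?S \<inter> U \<Longrightarrow> flat_at F p x"
        by auto
      obtain C where C: "countable C" "\<And>a b. (a, b) \<in> C \<Longrightarrow> a < b \<and> {a..b} \<subseteq> U"
          "disjoint_family_on (\<lambda>(a, b). {a..b}) C" "negligible (?S \<inter> U - (\<Union>(a, b)\<in>C. {a<..<b}))"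
          "(\<integral>\<^sup>+i. ennreal (F (snd i) - F (fst i)) \<partial>count_space C) \<le> ennreal p * emeasure lborel U"
        by (rule flat_cover[OF p U(1) flat]; (assumption | (rule that; blast)))
      let ?S' = "?S \<inter> (\<Union>(a, b)\<in>C. {a<..<b})"
      have steep: "\<And>c d. (c, d) \<in> C \<Longrightarrow> c < d" "?S' \<subseteq> (\<Union>(a, b)\<in>C. {a<..<b})"
          "\<And>x. x \<in> ?S' \<Longrightarrow> steep_at F q x"
        using C(2) by auto
      obtain V where V: "open V" "negligible (?S' - V)"
          "ennreal q * emeasure lborel V \<le> (\<integral>\<^sup>+i. ennreal (F (snd i) - F (fst i)) \<partial>count_space C)"
        by (rule steep_cover[OF F q C(3,1) steep])
      have "negligible ((?S - U) \<union> (?S \<inter> U - (\<Union>(a, b)\<in>C. {a<..<b})) \<union> (?S' - V))"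
        using U(2) C(4) V(2) by (intro negligible_Un)
      then have "negligible (?S - V)"
        by (rule negligible_subset) auto
      have "emeasure lborel V = ennreal (1 / q) * (ennreal q * emeasure lborel V)"
        using q by (simp add: mult.assoc[symmetric] ennreal_mult'[symmetric])
      also have "\<dots> \<le> ennreal (1 / q) * (ennreal p * ennreal m)"
        using order_trans[OF V(3) C(5)] U(3)
        by (meson mult_left_mono order_trans zero_le)
      also have "\<dots> = ennreal ((p / q) * m)"
        using p q by (simp add: ennreal_mult'[symmetric])
      finally show ?thesis
        using V(1) \<open>negligible (?S - V)\<close> by blast
    qed
    have iter: "\<exists>V. open V \<and> negligible (?S - V) \<and> emeasure lborel V \<le> ennreal ((p / q) ^ k * (2 * n))" for k
    proof (induction k)
      case 0
      have "?S - {-n<..<n} = {}" by auto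
      then have "negligible (?S - {-n<..<n})" by (simp only: negligible_empty)
      moreover have "emeasure lborel {-n<..<n} \<le> ennreal ((p / q) ^ 0 * (2 * n))"
        using n by simp
      ultimately show ?case
        using open_greaterThanLessThan by blast
    next
      case (Suc k)
      then obtain U where "open U" "negligible (?S - U)" "emeasure lborel U \<le> ennreal ((p / q) ^ k * (2 * n))"
        by blast
      from shrink[OF this] show ?case
        by (simp only: power_Suc mult.assoc)
    qed
    fix e :: real
    assume e: "0 < e"
    have "(\<lambda>k. (p / q) ^ k * (2 * n)) \<longlonglongrightarrow> 0 * (2 * n)"
      using p pq by (intro tendsto_intros LIMSEQ_power_zero) auto
    then have "\<forall>\<^sub>F k in sequentially. (p / q) ^ k * (2 * n) < e"
      using e by (intro order_tendstoD) auto
    then obtain k where "(p / q) ^ k * (2 * n) < e"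
      by (auto simp: eventually_sequentially)
    then show "\<exists>V. open V \<and> negligible (?S - V) \<and> emeasure lborel V \<le> ennreal e"
      using iter[of k] by (meson ennreal_leI less_imp_le order_trans)
  qed
  note bounded = this
  show ?thesis
  proof (subst negligible_on_intervals, intro allI)
    fix a b :: real
    have "0 < \<bar>a\<bar> + \<bar>b\<bar> + 1" by simp
    from bounded[OF this] show "negligible ({x. flat_at F p x \<and> steep_at F q x} \<inter> cbox a b)"
      by (rule negligible_subset) auto
  qed
qed

text \<open>
  Over a bounded interval \<open>F\<close> has only a finite growth \<open>h\<close> to spend, so intervals of slope
  \<open>q\<close> have total length at most \<open>h / q\<close>, whatever \<open>q\<close> is.
\<close>

lemma negligible_infinitely_steep:
  assumes F: "mono F"
  shows "negligible {x. \<forall>q. steep_at F q x}"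
proof -
  have "negligible {x\<in>{-n<..<n}. \<forall>q. steep_at F q x}" (is "negligible ?S") if n: "0 < n" for n :: real
  proof (rule negligible_if_essentially_covered)
    fix e :: real
    assume e: "0 < e"
    define h where "h = F n - F (- n)"
    have h: "0 \<le> h"
      using monoD[OF F, of "-n" n] n by (simp add: h_def)
    \<comment> \<open>With this \<open>q\<close>, steep intervals inside \<open>(-n, n)\<close> have total length at most \<open>h / q < e\<close>.\<close>
    define q where "q = (h + 1) / e"
    have q: "0 < q"
      using h e by (simp add: q_def)
    have steep: "disjoint_family_on (\<lambda>(c, d). {c..d}) {(-n, n)}" "countable {(-n, n)}"
      "\<And>c d. (c, d) \<in> {(-n, n)} \<Longrightarrow> c < d" "?S \<subseteq> (\<Union>(c, d)\<in>{(-n, n)}. {c<..<d})"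
      "\<And>x. x \<in> ?S \<Longrightarrow> steep_at F q x"
      using n by (auto simp: disjoint_family_on_def)
    obtain V where V: "open V" "negligible (?S - V)"
      "ennreal q * emeasure lborel V \<le> (\<integral>\<^sup>+i. ennreal (F (snd i) - F (fst i)) \<partial>count_space {(-n, n)})"
      by (rule steep_cover[OF F q steep])
    have "emeasure lborel V = ennreal (1 / q) * (ennreal q * emeasure lborel V)"
      using q by (simp add: mult.assoc[symmetric] ennreal_mult'[symmetric])
    also have "\<dots> \<le> ennreal (1 / q) * ennreal h"
      using V(3) by (intro mult_left_mono) (auto simp: h_def nn_integral_count_space_finite)
    also have "\<dots> = ennreal (h / q)"
      using q h by (simp flip: ennreal_mult')
    also have "\<dots> \<le> ennreal e"
      using h e by (intro ennreal_leI) (simp add: q_def field_simps)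
    finally show "\<exists>V. open V \<and> negligible (?S - V) \<and> emeasure lborel V \<le> ennreal e"
      using V by blast
  qed
  note bounded = this
  show ?thesis
  proof (subst negligible_on_intervals, intro allI)
    fix a b :: real
    have "0 < \<bar>a\<bar> + \<bar>b\<bar> + 1" by simp
    from bounded[OF this] show "negligible ({x. \<forall>q. steep_at F q x} \<inter> cbox a b)"
      by (rule negligible_subset) auto
  qed
qed

lemma steep_at_antimono:
  assumes "steep_at F q x" "p \<le> q"
  shows "steep_at F p x"
  unfolding steep_at_def
proof (intro allI impI)
  fix d :: real assume "0 < d"
  then obtain a b where ab: "a < b" "a \<le> x" "x \<le> b" "b - a < d" "q * (b - a) < F b - F a"
    using assms(1) unfolding steep_at_def by blast
  moreover have "p * (b - a) \<le> q * (b - a)"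
    using assms(2) ab(1) by (intro mult_right_mono) auto
  ultimately show "\<exists>a b. a < b \<and> a \<le> x \<and> x \<le> b \<and> b - a < d \<and> p * (b - a) < F b - F a"
    by (intro exI[of _ a] exI[of _ b] conjI) (assumption | linarith)+
qed

text \<open>
  The derivative is the supremum \<open>L\<close> of the slopes at which \<open>x\<close> is steep.  Above \<open>L\<close>,
  short intervals are not steeper by definition; below \<open>L\<close>, they are not flatter,
  because a rational gap between flatness and steepness is excluded.
\<close>

lemma differentiable_if_not_flat_and_steep:
  assumes F: "mono F" and fin: "\<not> (\<forall>q. steep_at F q x)"
    and no: "\<And>p q. p \<in> \<rat> \<Longrightarrow> q \<in> \<rat> \<Longrightarrow> p < q \<Longrightarrow> \<not> (flat_at F p x \<and> steep_at F q x)"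
  shows "F differentiable (at x)"
proof -
  define Q where "Q = {q. steep_at F q x}"
  have ne: "-1 \<in> Q"
    unfolding Q_def steep_at_def
  proof safe
    fix d :: real assume "0 < d"
    then show "\<exists>a b. a < b \<and> a \<le> x \<and> x \<le> b \<and> b - a < d \<and> - 1 * (b - a) < F b - F a"
      using monoD[OF F, of x "x + d / 2"] by (intro exI[of _ x] exI[of _ "x + d / 2"]) auto
  qed
  obtain u where u: "\<not> steep_at F u x"
    using fin by blast
  have "q \<le> u" if "q \<in> Q" for q
    using that u steep_at_antimono[of F q x u] unfolding Q_def by force
  then have bdd: "bdd_above Q"
    by (rule bdd_aboveI)
  define L where "L = Sup Q"
  have upper: "\<exists>d>0. \<forall>a b. a < b \<longrightarrow> a \<le> x \<longrightarrow> x \<le> b \<longrightarrow> b - a < d \<longrightarrow> F b - F a \<le> (L + e) * (b - a)"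
    if "0 < e" for e
  proof -
    have "L + e \<notin> Q"
      using cSup_upper[OF _ bdd, of "L + e"] that by (auto simp: L_def)
    then show ?thesis
      unfolding Q_def mem_Collect_eq steep_at_def by (meson not_less)
  qed
  have lower: "\<exists>d>0. \<forall>a b. a < b \<longrightarrow> a \<le> x \<longrightarrow> x \<le> b \<longrightarrow> b - a < d \<longrightarrow> (L - e) * (b - a) \<le> F b - F a"
    if e: "0 < e" for e
  proof -
    obtain q where q: "q \<in> \<rat>" "L - e < q" "q < L"
      using Rats_dense_in_real[of "L - e" L] e by auto
    obtain p where p: "p \<in> \<rat>" "L - e < p" "p < q"
      using Rats_dense_in_real[of "L - e" q] q by blast
    have "\<exists>q'\<in>Q. q < q'"
      using less_cSupD[of Q q] ne q unfolding L_def by blast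
    then obtain q' where "q' \<in> Q" "q < q'"
      by blast
    then have "steep_at F q x"
      using steep_at_antimono[of F q' x q] by (auto simp: Q_def)
    then have "\<not> flat_at F p x"
      using no p q by blast
    then obtain d where d: "d > 0" "\<And>a b. a < b \<Longrightarrow> a \<le> x \<Longrightarrow> x \<le> b \<Longrightarrow> b - a < d \<Longrightarrow> p * (b - a) \<le> F b - F a"
      unfolding flat_at_def by (meson not_less)
    have "(L - e) * (b - a) \<le> F b - F a" if "a < b" "a \<le> x" "x \<le> b" "b - a < d" for a b
      using d(2)[OF that] p that mult_right_mono[of "L - e" p "b - a"] by linarith
    then show ?thesis
      using d by blast
  qed
  have "((\<lambda>y. (F y - F x) / (y - x)) \<longlongrightarrow> L) (at x)"
    unfolding LIM_def
  proof safe
    fix e :: real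
    assume "0 < e"
    then have e2: "0 < e / 2" by simp
    obtain d1 where d1: "d1 > 0" "\<And>a b. a < b \<Longrightarrow> a \<le> x \<Longrightarrow> x \<le> b \<Longrightarrow> b - a < d1 \<Longrightarrow> F b - F a \<le> (L + e / 2) * (b - a)"
      using upper[OF e2] by blast
    obtain d2 where d2: "d2 > 0" "\<And>a b. a < b \<Longrightarrow> a \<le> x \<Longrightarrow> x \<le> b \<Longrightarrow> b - a < d2 \<Longrightarrow> (L - e / 2) * (b - a) \<le> F b - F a"
      using lower[OF e2] by blast
    have "dist ((F y - F x) / (y - x)) L < e" if y: "y \<noteq> x" "dist y x < min d1 d2" for y
    proof -
      have "L - e / 2 \<le> (F y - F x) / (y - x) \<and> (F y - F x) / (y - x) \<le> L + e / 2"
      proof (cases "x < y")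
        case True
        then show ?thesis
          using d1(2)[of x y] d2(2)[of x y] y by (auto simp: dist_real_def pos_divide_le_eq pos_le_divide_eq)
      next
        case False
        then have "y < x" using y by simp
        moreover have "(F y - F x) / (y - x) = (F x - F y) / (x - y)"
          using minus_divide_divide[of "F x - F y" "x - y"] by simp
        ultimately show ?thesis
          using d1(2)[of y x] d2(2)[of y x] y by (auto simp: dist_real_def pos_divide_le_eq pos_le_divide_eq)
      qed
      then show ?thesis
        using \<open>0 < e\<close> by (auto simp: dist_real_def abs_less_iff)
    qed
    then show "\<exists>s>0. \<forall>y. y \<noteq> x \<and> dist y x < s \<longrightarrow> dist ((F y - F x) / (y - x)) L < e"
      using d1(1) d2(1) by (intro exI[of _ "min d1 d2"]) auto
  qed
  then have "(F has_field_derivative L) (at x)"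
    by (simp add: has_field_derivative_iff)
  then show ?thesis
    by (auto simp: real_differentiable_def)
qed

text \<open>
  Lebesgue's theorem.  A point without derivative is infinitely steep, or else flat for some
  \<open>p\<close> and steep for some \<open>q > p\<close>; countably many rational pairs \<open>(p, q)\<close> suffice.
\<close>

theorem mono_differentiable_ae:
  fixes F :: "real \<Rightarrow> real"
  assumes F: "mono F"
  shows "negligible {x. \<not> F differentiable (at x)}"
proof (rule negligible_subset)
  show "negligible ({x. \<forall>q. steep_at F q x} \<union>
     (\<Union>(p, q)\<in>{(p, q)\<in>\<rat> \<times> \<rat>. p < q}. {x. flat_at F p x \<and> steep_at F q x}))"
  proof (intro negligible_Un negligible_infinitely_steep[OF F])
    have "countable {(p, q)\<in>\<rat> \<times> \<rat>. p < (q::real)}"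
      by (rule countable_subset[of _ "\<rat> \<times> \<rat>"]) (auto simp: countable_rat)
    then show "negligible (\<Union>(p, q)\<in>{(p, q)\<in>\<rat> \<times> \<rat>. p < q}. {x. flat_at F p x \<and> steep_at F q x})"
      unfolding negligible_iff_null_sets
      by (intro null_sets_UN') (auto simp: negligible_iff_null_sets[symmetric] intro!: negligible_flat_and_steep[OF F])
  qed
  show "{x. \<not> F differentiable (at x)} \<subseteq> {x. \<forall>q. steep_at F q x} \<union>
     (\<Union>(p, q)\<in>{(p, q)\<in>\<rat> \<times> \<rat>. p < q}. {x. flat_at F p x \<and> steep_at F q x})"
  proof
    fix x assume "x \<in> {x. \<not> F differentiable (at x)}"
    then have "(\<forall>q. steep_at F q x) \<or> (\<exists>p\<in>\<rat>. \<exists>q\<in>\<rat>. p < q \<and> flat_at F p x \<and> steep_at F q x)"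
      using differentiable_if_not_flat_and_steep[OF F, of x] by auto
    then show "x \<in> {x. \<forall>q. steep_at F q x} \<union>
       (\<Union>(p, q)\<in>{(p, q)\<in>\<rat> \<times> \<rat>. p < q}. {x. flat_at F p x \<and> steep_at F q x})"
      by auto
  qed
qed

section \<open>Absolutely continuous functions\<close>

lemma sum_lengths_le_emeasure:
  fixes D :: "(real \<times> real) set"
  assumes "finite D" "\<And>a b. (a, b) \<in> D \<Longrightarrow> a < b \<and> {a<..<b} \<subseteq> T"
    and disj: "disjoint_family_on (\<lambda>(a, b). {a<..<b}) D" and "T \<in> sets lebesgue"
  shows "ennreal (\<Sum>(a, b)\<in>D. b - a) \<le> emeasure lebesgue T"
proof -
  have disj': "disjoint_family_on (\<lambda>i. {fst i<..<snd i}) D"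
    using disj unfolding disjoint_family_on_def by (simp add: case_prod_beta)
  have le: "fst i \<le> snd i" if "i \<in> D" for i
    using assms(2)[of "fst i" "snd i"] that by simp
  have "open (\<Union>i\<in>D. {fst i<..<snd i})"
    by (intro open_UN ballI open_greaterThanLessThan)
  then have meas: "(\<Union>i\<in>D. {fst i<..<snd i}) \<in> sets lborel"
    by simp
  have "ennreal (\<Sum>(a, b)\<in>D. b - a) = (\<Sum>i\<in>D. ennreal (snd i - fst i))"
    using le by (subst sum_ennreal) (auto simp: case_prod_beta)
  also have "\<dots> = (\<integral>\<^sup>+i. ennreal (snd i - fst i) \<partial>count_space D)"
    using \<open>finite D\<close> by (simp add: nn_integral_count_space_finite)
  also have "\<dots> = emeasure lborel (\<Union>i\<in>D. {fst i<..<snd i})"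
    using \<open>finite D\<close> disj' le by (subst emeasure_disjoint_intervals) (auto simp: countable_finite)
  also have "\<dots> = emeasure lebesgue (\<Union>i\<in>D. {fst i<..<snd i})"
    using meas by simp
  also have "\<dots> \<le> emeasure lebesgue T"
    using assms by (intro emeasure_mono) fastforce+
  finally show ?thesis .
qed

text \<open>
  Both \<open>V\<close> and \<open>V - f\<close> are monotone, and \<open>f\<close> is their difference.
\<close>

lemma differentiable_ae_if_dominated_variation:
  fixes f V :: "real \<Rightarrow> real"
  assumes "\<And>x y. x \<le> y \<Longrightarrow> \<bar>f y - f x\<bar> \<le> V y - V x"
  shows "negligible {x. \<not> f differentiable (at x)}"
proof -
  have "mono V"
    using assms by (intro monoI) (metis abs_ge_zero diff_ge_0_iff_ge order_trans)
  moreover have "mono (\<lambda>x. V x - f x)"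
    using assms by (intro monoI) (smt (verit))
  ultimately have "negligible ({x. \<not> V differentiable (at x)} \<union> {x. \<not> (\<lambda>x. V x - f x) differentiable (at x)})"
    using mono_differentiable_ae by (intro negligible_Un) auto
  then show ?thesis
  proof (rule negligible_subset, safe)
    fix x assume d: "\<not> f differentiable at x" "(\<lambda>x. V x - f x) differentiable at x" "V differentiable at x"
    have "(\<lambda>x. V x - (V x - f x)) differentiable at x"
      by (rule differentiable_diff[OF d(3) d(2)])
    also have "(\<lambda>x. V x - (V x - f x)) = f"
      by auto
    finally show False
      using d(1) by blast
  qed
qed

text \<open>
  The finite families of intervals over which the definition of absolute continuity
  quantifies; naming them lets the same families define the variation function.
\<close>

definition interval_families :: "real set \<Rightarrow> (real \<times> real) set set" where
  "interval_families I = {D. finite D \<and> (\<forall>(a, b)\<in>D. a < b \<and> {a..b} \<subseteq> I) \<and>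
     disjoint_family_on (\<lambda>(a, b). {a<..<b}) D}"

definition variation_sum :: "(real \<Rightarrow> complex) \<Rightarrow> (real \<times> real) set \<Rightarrow> real" where
  "variation_sum g D = (\<Sum>(a, b)\<in>D. norm (g b - g a))"

lemma abs_continuous_on_iff:
  "abs_continuous_on I g \<longleftrightarrow>
     (\<forall>\<epsilon>>0. \<exists>\<delta>>0. \<forall>D\<in>interval_families I. (\<Sum>(a, b)\<in>D. b - a) < \<delta> \<longrightarrow> variation_sum g D < \<epsilon>)"
  unfolding abs_continuous_on_def interval_families_def variation_sum_def
  by (simp add: imp_conjL Ball_def)

lemma abs_continuous_onE:
  assumes "abs_continuous_on I g" "0 < \<epsilon>"
  obtains \<delta> where "0 < \<delta>"
    "\<And>D. D \<in> interval_families I \<Longrightarrow> (\<Sum>(a, b)\<in>D. b - a) < \<delta> \<Longrightarrow> variation_sum g D < \<epsilon>"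
  using assms unfolding abs_continuous_on_iff by blast

text \<open>
  An interval \<open>(x, y)\<close> can be added to any family in \<open>[c, x]\<close>, which makes the
  variation function superadditive.  That is all that the decomposition into monotone
  functions needs.
\<close>

lemma increment_le_variation:
  assumes bdd: "bdd_above (variation_sum g ` interval_families {c..d})"
    and xy: "c \<le> x" "x \<le> y" "y \<le> d"
  defines "V \<equiv> \<lambda>x. Sup (variation_sum g ` interval_families {c..x})"
  shows "norm (g y - g x) \<le> V y - V x"
proof (cases "x = y")
  case False
  then have "x < y" using xy by simp
  have sub: "interval_families {c..u} \<subseteq> interval_families {c..d}" if "u \<le> d" for u
    using that unfolding interval_families_def by fastforce
  have bddy: "bdd_above (variation_sum g ` interval_families {c..y})"
    using bdd sub[OF xy(3)] by (meson bdd_above_mono image_mono)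
  have ne: "variation_sum g ` interval_families {c..x} \<noteq> {}"
    unfolding interval_families_def by (auto simp: disjoint_family_on_def intro!: exI[of _ "{}"])
  have "V x \<le> V y - norm (g y - g x)"
    unfolding V_def
  proof (rule cSup_least[OF ne])
    fix s assume "s \<in> variation_sum g ` interval_families {c..x}"
    then obtain D where D: "D \<in> interval_families {c..x}" and s: "s = variation_sum g D"
      by blast
    have le: "b \<le> x" "a < b" "c \<le> a" if "(a, b) \<in> D" for a b
      using D that unfolding interval_families_def by fastforce+
    have new: "(x, y) \<notin> D"
      using le[of x y] \<open>x < y\<close> by auto
    have "insert (x, y) D \<in> interval_families {c..y}"
      using D le \<open>x < y\<close> xy new unfolding interval_families_def
      by (fastforce simp: disjoint_family_on_insert)
    moreover have "variation_sum g (insert (x, y) D) = norm (g y - g x) + s"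
      using D new unfolding s variation_sum_def interval_families_def by simp
    ultimately have "norm (g y - g x) + s \<le> Sup (variation_sum g ` interval_families {c..y})"
      using bddy by (metis cSup_upper imageI)
    then show "s \<le> Sup (variation_sum g ` interval_families {c..y}) - norm (g y - g x)"
      by simp
  qed
  then show ?thesis
    by simp
next
  case True
  then show ?thesis by simp
qed

text \<open>
  Differentiability is a local matter, and on an interval shorter than the \<open>\<delta>\<close> that
  belongs to \<open>\<epsilon> = 1\<close> all variation sums are at most 1.  So the variation function \<open>V\<close> is
  finite there, and every real component of \<open>g\<close> is the difference of the monotone
  functions \<open>V\<close> and \<open>V\<close> minus the component.
\<close>

theorem abs_continuous_differentiable_ae:
  assumes g: "abs_continuous_on UNIV g"
  shows "negligible {x. \<not> g differentiable (at x)}"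
proof -
  obtain \<delta> where \<delta>: "0 < \<delta>"
    and small: "\<And>D. D \<in> interval_families UNIV \<Longrightarrow> (\<Sum>(a, b)\<in>D. b - a) < \<delta> \<Longrightarrow> variation_sum g D < 1"
    using abs_continuous_onE[OF g zero_less_one] by blast
  have short: "negligible {x\<in>{c<..<d}. \<not> g differentiable (at x)}" if cd: "c < d" "d - c < \<delta>" for c d
  proof -
    have "variation_sum g D \<le> 1" if D: "D \<in> interval_families {c..d}" for D
    proof -
      have "ennreal (\<Sum>(a, b)\<in>D. b - a) \<le> emeasure lebesgue {c..d}"
        using D unfolding interval_families_def by (intro sum_lengths_le_emeasure) fastforce+
      then have "(\<Sum>(a, b)\<in>D. b - a) < \<delta>"
        using cd by (simp add: ennreal_le_iff)
      moreover have "D \<in> interval_families UNIV"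
        using D unfolding interval_families_def by auto
      ultimately show ?thesis
        using small by (simp add: less_imp_le)
    qed
    then have bdd: "bdd_above (variation_sum g ` interval_families {c..d})"
      by (intro bdd_aboveI2)
    define V where "V = (\<lambda>x. Sup (variation_sum g ` interval_families {c..x}))"
    \<comment> \<open>Composing with the retraction onto \<open>[c, d]\<close> extends \<open>g\<close> and \<open>V\<close> to the line and keeps
      the increments of \<open>g\<close> bounded by those of \<open>V\<close>.\<close>
    define cl where "cl = (\<lambda>x. max c (min d x))"
    have incr: "norm (g (cl y) - g (cl x)) \<le> V (cl y) - V (cl x)" if "x \<le> y" for x y
      unfolding V_def using that cd by (intro increment_le_variation[OF bdd]) (auto simp: cl_def)
    have "negligible {x. \<not> (\<lambda>x. g (cl x) \<bullet> i) differentiable (at x)}" if "i \<in> Basis" for i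
    proof (rule differentiable_ae_if_dominated_variation)
      fix x y :: real assume "x \<le> y"
      have "\<bar>(g (cl y) - g (cl x)) \<bullet> i\<bar> \<le> norm (g (cl y) - g (cl x))"
        using that by (rule Basis_le_norm)
      then show "\<bar>g (cl y) \<bullet> i - g (cl x) \<bullet> i\<bar> \<le> V (cl y) - V (cl x)"
        using incr[OF \<open>x \<le> y\<close>] by (simp add: inner_diff_left)
    qed
    then have neg: "negligible (\<Union>i\<in>Basis. {x. \<not> (\<lambda>x. g (cl x) \<bullet> i) differentiable (at x)})"
      by (intro negligible_Union) auto
    show ?thesis
    proof (rule negligible_subset[OF neg], intro subsetI, rule ccontr)
      fix x
      assume "x \<in> {x \<in> {c<..<d}. \<not> g differentiable at x}"
      then have x: "x \<in> {c<..<d}" "\<not> g differentiable at x"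
        by auto
      assume "x \<notin> (\<Union>i\<in>Basis. {x. \<not> (\<lambda>x. g (cl x) \<bullet> i) differentiable (at x)})"
      then have "(\<lambda>x. g (cl x)) differentiable at x"
        by (subst differentiable_componentwise_within) auto
      then obtain g' where g': "((\<lambda>x. g (cl x)) has_derivative g') (at x)"
        unfolding differentiable_def by blast
      have "(g has_derivative g') (at x)"
        by (rule has_derivative_transform_within_open[OF g', of "{c<..<d}"]) (use x in \<open>auto simp: cl_def\<close>)
      then show False
        using x unfolding differentiable_def by blast
    qed
  qed
  show ?thesis
  proof (rule locally_negligible_alt[THEN iffD2], rule ballI)
    let ?S = "{x. \<not> g differentiable (at x)}"
    fix x assume x: "x \<in> ?S"
    let ?I = "{x - \<delta> / 4<..<x + \<delta> / 4}"
    have "openin (top_of_set ?S) (?S \<inter> ?I)"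
      by (rule openin_open_Int) (rule open_greaterThanLessThan)
    moreover have "x \<in> ?S \<inter> ?I"
      using \<delta> x by simp
    moreover have "negligible (?S \<inter> ?I)"
    proof (rule negligible_subset)
      show "negligible {y\<in>?I. \<not> g differentiable (at y)}"
        by (rule short) (use \<delta> in auto)
    qed auto
    ultimately show "\<exists>U. openin (top_of_set ?S) U \<and> x \<in> U \<and> negligible U"
      by (intro exI[of _ "?S \<inter> ?I"] conjI)
  qed
qed

text \<open>
  The fundamental theorem of calculus, proved with the gauge integral, where the
  integrability of the derivative is part of the conclusion.  In a fine tagged
  division, the intervals with tag outside \<open>N\<close> contribute a small error by
  differentiability.  The intervals with tag in \<open>N\<close> lie in an open set of small
  measure, so by absolute continuity the increments of \<open>f\<close> over them have a small sum.
\<close>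

theorem abs_continuous_FTC:
  fixes f :: "real \<Rightarrow> complex"
  assumes "a \<le> b" and AC: "abs_continuous_on {a..b} f" and N: "negligible N"
    and deriv: "\<And>t. t \<in> {a..b} - N \<Longrightarrow> (f has_vector_derivative f' t) (at t within {a..b})"
  shows "(f' has_integral f b - f a) {a..b}"
proof -
  define h where "h = (\<lambda>x. if x \<in> N then 0 else f' x)"
  have "(h has_integral f b - f a) {a..b}"
    unfolding has_integral_real
  proof (intro allI impI)
    fix e :: real assume e: "0 < e"
    define \<eta> where "\<eta> = e / (2 * (b - a + 1))"
    have \<eta>: "0 < \<eta>" "\<eta> * (b - a) < e / 2"
      using e \<open>a \<le> b\<close> by (auto simp: \<eta>_def field_simps)
    obtain \<delta> where \<delta>: "0 < \<delta>"
      and small: "\<And>D. D \<in> interval_families {a..b} \<Longrightarrow> (\<Sum>(a, b)\<in>D. b - a) < \<delta> \<Longrightarrow> variation_sum f D < e / 2"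
      using abs_continuous_onE[OF AC half_gt_zero[OF e]] by blast
    have null: "N \<in> null_sets lebesgue"
      using N by (simp add: negligible_iff_null_sets)
    obtain T where T: "open T" "N \<subseteq> T" "emeasure lebesgue (T - N) < ennreal \<delta>"
      using sets_lebesgue_outer_open[of N \<delta>] null \<delta> by blast
    have T_small: "emeasure lebesgue T < ennreal \<delta>"
      using T(1,3) null by (simp add: emeasure_Diff_null_set)
    have "\<exists>d>0. x \<in> {a..b} - N \<longrightarrow> (\<forall>y\<in>{a..b}. \<bar>y - x\<bar> < d \<longrightarrow>
            norm (f y - f x - (y - x) *\<^sub>R h x) \<le> \<eta> * \<bar>y - x\<bar>)" for x
    proof (cases "x \<in> {a..b} - N")
      case True
      then have "(f has_derivative (\<lambda>t. t *\<^sub>R h x)) (at x within {a..b})"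
        using deriv by (simp add: h_def has_vector_derivative_def)
      then show ?thesis
        using \<eta> unfolding has_derivative_within_alt by (auto simp: real_norm_def)
    next
      case False
      then show ?thesis
        by (intro exI[of _ 1] conjI impI zero_less_one) (erule notE)
    qed
    then obtain d where d: "\<And>x. 0 < d x"
      and approx: "\<And>x y. x \<in> {a..b} - N \<Longrightarrow> y \<in> {a..b} \<Longrightarrow> \<bar>y - x\<bar> < d x \<Longrightarrow>
            norm (f y - f x - (y - x) *\<^sub>R h x) \<le> \<eta> * \<bar>y - x\<bar>"
      by metis
    define \<gamma> where "\<gamma> = (\<lambda>x. if x \<in> N then T else ball x (d x))"
    have gauge: "gauge \<gamma>"
      using T d by (auto simp: gauge_def \<gamma>_def)
    have close: "norm ((\<Sum>(x, K)\<in>p. measure lborel K *\<^sub>R h x) - (f b - f a)) < e"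
      if p: "p tagged_division_of {a..b}" "\<gamma> fine p" for p
    proof -
      define err where "err = (\<lambda>(x, K). measure lborel K *\<^sub>R h x - (f (Sup K) - f (Inf K)))"
      have fin: "finite p"
        using tagged_division_ofD(1)[OF p(1)] .
      have K: "\<exists>u v. K = {u..v} \<and> u \<le> x \<and> x \<le> v \<and> a \<le> u \<and> v \<le> b \<and> K \<subseteq> \<gamma> x" if xK: "(x, K) \<in> p" for x K
      proof -
        obtain u v where uv: "K = cbox u v"
          using tagged_division_ofD(4)[OF p(1) xK] by blast
        have "x \<in> K" "K \<subseteq> {a..b}"
          using tagged_division_ofD(2,3)[OF p(1) xK] .
        moreover have "K \<subseteq> \<gamma> x"
          using fineD[OF p(2) xK] .
        ultimately show ?thesis
          using uv by (intro exI[of _ u] exI[of _ v]) auto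
      qed
      \<comment> \<open>Degenerate intervals must be left out of \<open>p2\<close>: they contribute nothing, but the families
        in the definition of absolute continuity consist of nondegenerate intervals.\<close>
      define p1 where "p1 = {i \<in> p. fst i \<notin> N}"
      define p2 where "p2 = {i \<in> p. fst i \<in> N \<and> Inf (snd i) < Sup (snd i)}"
      have err1: "norm (err i) \<le> \<eta> * measure lborel (snd i)" if i: "i \<in> p1" for i
      proof -
        obtain x K where xK: "i = (x, K)" "(x, K) \<in> p" "x \<notin> N"
          using i by (cases i) (auto simp: p1_def)
        obtain u v where uv: "K = {u..v}" "u \<le> x" "x \<le> v" "a \<le> u" "v \<le> b" "K \<subseteq> ball x (d x)"
          using K[OF xK(2)] xK(3) by (auto simp: \<gamma>_def)
        have "u \<in> K" "v \<in> K"
          using uv by auto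
        then have "\<bar>u - x\<bar> < d x" "\<bar>v - x\<bar> < d x"
          using uv(6) by (auto simp: dist_real_def abs_minus_commute subset_iff)
        then have A: "norm (f u - f x - (u - x) *\<^sub>R h x) \<le> \<eta> * (x - u)"
          "norm (f v - f x - (v - x) *\<^sub>R h x) \<le> \<eta> * (v - x)"
          using approx[of x u] approx[of x v] uv xK by auto
        have "err i = (f u - f x - (u - x) *\<^sub>R h x) - (f v - f x - (v - x) *\<^sub>R h x)"
          using uv by (simp add: err_def xK algebra_simps)
        also have "norm \<dots> \<le> \<eta> * (x - u) + \<eta> * (v - x)"
          using A by (meson add_mono norm_triangle_ineq4 order_trans)
        finally show ?thesis
          using uv by (simp add: xK algebra_simps)
      qed
      have "norm (sum err p1) \<le> (\<Sum>i\<in>p1. \<eta> * measure lborel (snd i))"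
        using err1 by (rule sum_norm_le)
      also have "\<dots> \<le> (\<Sum>i\<in>p. \<eta> * measure lborel (snd i))"
        using fin \<eta> by (intro sum_mono2) (auto simp: p1_def)
      also have "\<dots> = \<eta> * (b - a)"
        using additive_content_tagged_division[of p a b] p \<open>a \<le> b\<close>
        by (simp add: sum_distrib_left[symmetric] case_prod_beta)
      finally have sum1: "norm (sum err p1) < e / 2"
        using \<eta> by simp
      define D where "D = (\<lambda>i. (Inf (snd i), Sup (snd i))) ` p2"
      have same: "i = j" if i: "i \<in> p2" and j: "j \<in> p2" and "z \<in> {Inf (snd i)<..<Sup (snd i)}" "z \<in> {Inf (snd j)<..<Sup (snd j)}" for i j z
      proof (rule ccontr)
        assume "i \<noteq> j"
        have "interior (snd i) \<inter> interior (snd j) = {}"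
          using tagged_division_ofD(5)[OF p(1), of "fst i" "snd i" "fst j" "snd j"] i j \<open>i \<noteq> j\<close>
          by (auto simp: p2_def prod_eq_iff)
        moreover obtain u v where "snd i = {u..v}" "u \<le> v"
          using K[of "fst i" "snd i"] i by (auto simp: p2_def)
        moreover obtain u' v' where "snd j = {u'..v'}" "u' \<le> v'"
          using K[of "fst j" "snd j"] j by (auto simp: p2_def)
        ultimately show False
          using that(3,4) by (auto simp: interior_atLeastAtMost_real)
      qed
      have inj: "inj_on (\<lambda>i. (Inf (snd i), Sup (snd i))) p2"
      proof (rule inj_onI)
        fix i j assume ij: "i \<in> p2" "j \<in> p2" "(Inf (snd i), Sup (snd i)) = (Inf (snd j), Sup (snd j))"
        obtain z where "Inf (snd i) < z" "z < Sup (snd i)"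
          using ij(1) dense unfolding p2_def by blast
        then show "i = j"
          using ij by (intro same[of i j z]) auto
      qed
      have Dp: "a' < b' \<and> {a'..b'} \<subseteq> {a..b} \<and> {a'..b'} \<subseteq> T" if D: "(a', b') \<in> D" for a' b'
      proof -
        obtain x L where "(x, L) \<in> p" "x \<in> N" "a' = Inf L" "b' = Sup L" "a' < b'"
          using D by (auto simp: D_def p2_def)
        then show ?thesis
          using K[of x L] by (auto simp: \<gamma>_def)
      qed
      have fam: "D \<in> interval_families {a..b}"
        unfolding interval_families_def
      proof (intro CollectI conjI)
        show "\<forall>(a', b')\<in>D. a' < b' \<and> {a'..b'} \<subseteq> {a..b}"
          using Dp by blast
        show "finite D"
          using fin by (simp add: D_def p2_def)
        show "disjoint_family_on (\<lambda>(a, b). {a<..<b}) D"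
          unfolding disjoint_family_on_def D_def using same by fastforce
      qed
      have "ennreal (\<Sum>(a, b)\<in>D. b - a) \<le> emeasure lebesgue T"
      proof (rule sum_lengths_le_emeasure)
        show "a' < b' \<and> {a'<..<b'} \<subseteq> T" if "(a', b') \<in> D" for a' b'
          using Dp[OF that] by (meson greaterThanLessThan_subseteq_atLeastAtMost_iff order_refl order_trans)
        show "finite D" "disjoint_family_on (\<lambda>(a, b). {a<..<b}) D"
          using fam by (simp_all add: interval_families_def)
        show "T \<in> sets lebesgue"
          using T(1) by simp
      qed
      then have "ennreal (\<Sum>(a, b)\<in>D. b - a) < ennreal \<delta>"
        using T_small by (rule le_less_trans)
      moreover have "0 \<le> (\<Sum>(a, b)\<in>D. b - a)"
        using Dp by (intro sum_nonneg) fastforce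
      ultimately have "variation_sum f D < e / 2"
        by (intro small fam) (simp add: ennreal_less_iff)
      moreover have "variation_sum f D = (\<Sum>i\<in>p2. norm (f (Sup (snd i)) - f (Inf (snd i))))"
        unfolding variation_sum_def D_def by (subst sum.reindex[OF inj]) (simp add: o_def)
      moreover have "norm (sum err p2) \<le> (\<Sum>i\<in>p2. norm (f (Sup (snd i)) - f (Inf (snd i))))"
        by (rule sum_norm_le) (auto simp: err_def p2_def h_def norm_minus_commute)
      ultimately have sum2: "norm (sum err p2) < e / 2"
        by simp
      have "sum err p = sum err (p1 \<union> p2)"
      proof (rule sum.mono_neutral_right[OF fin])
        show "p1 \<union> p2 \<subseteq> p"
          by (auto simp: p1_def p2_def)
        show "\<forall>i\<in>p - (p1 \<union> p2). err i = 0"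
        proof
          fix i assume i: "i \<in> p - (p1 \<union> p2)"
          obtain u v where "snd i = {u..v}" "u \<le> v"
            using K[of "fst i" "snd i"] i by auto
          then show "err i = 0"
            using i by (cases i) (auto simp: err_def p1_def p2_def)
        qed
      qed
      also have "\<dots> = sum err p1 + sum err p2"
        using fin by (intro sum.union_disjoint) (auto simp: p1_def p2_def)
      finally have "norm (sum err p) < e"
        using sum1 sum2 norm_triangle_ineq[of "sum err p1" "sum err p2"] by simp
      moreover have "(\<Sum>(x, K)\<in>p. measure lborel K *\<^sub>R h x) - (f b - f a) = sum err p"
        using additive_tagged_division_1[OF \<open>a \<le> b\<close> p(1), of f]
        by (simp add: err_def case_prod_beta sum_subtractf)
      ultimately show ?thesis
        by simp
    qed
    show "\<exists>\<gamma>. gauge \<gamma> \<and> (\<forall>p. p tagged_division_of {a..b} \<and> \<gamma> fine p \<longrightarrow>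
        norm ((\<Sum>(x, K)\<in>p. measure lborel K *\<^sub>R h x) - (f b - f a)) < e)"
      using gauge close by (intro exI[of _ \<gamma>]) simp
  qed
  then show ?thesis
    using has_integral_spike[OF N, of "{a..b}" f' h "f b - f a"] by (simp add: h_def)
qed

lemma abs_continuous_imp_continuous:
  assumes "abs_continuous_on UNIV g"
  shows "continuous_on A g"
proof -
  have "\<exists>d>0. \<forall>y. dist y x < d \<longrightarrow> dist (g y) (g x) < e" if "0 < e" for x e
  proof -
    obtain d where d: "0 < d"
      and small: "\<And>D. D \<in> interval_families UNIV \<Longrightarrow> (\<Sum>(a, b)\<in>D. b - a) < d \<Longrightarrow> variation_sum g D < e"
      using abs_continuous_onE[OF assms \<open>0 < e\<close>] by blast
    have inc: "norm (g b - g a) < e" if "a < b" "b - a < d" for a b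
      using small[of "{(a, b)}"] that
      by (simp add: interval_families_def variation_sum_def disjoint_family_on_def)
    have "dist (g y) (g x) < e" if "dist y x < d" for y
      using inc[of x y] inc[of y x] that \<open>0 < e\<close>
      by (cases x y rule: linorder_cases) (auto simp: dist_norm norm_minus_commute)
    then show ?thesis
      using d by blast
  qed
  then have "continuous_on UNIV g"
    unfolding continuous_on_iff by simp
  then show ?thesis
    by (rule continuous_on_subset) simp
qed

text \<open>
  Over a bounded interval, \<open>g\<close> is bounded by some \<open>M\<close>, so an increment of the product
  is at most the increment of \<open>g\<close> plus \<open>M * K\<close> times the length of the interval.
\<close>

lemma abs_continuous_mult_Lipschitz:
  assumes g: "abs_continuous_on UNIV g"
    and w: "\<And>t. norm (w t) \<le> 1" "\<And>s t. norm (w t - w s) \<le> K * \<bar>t - s\<bar>"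
  shows "abs_continuous_on {c..d} (\<lambda>t. g t * w t)"
proof -
  have K: "0 \<le> K"
    using order_trans[OF norm_ge_zero w(2)[of 1 0]] by simp
  have "compact (g ` {c..d})"
    using abs_continuous_imp_continuous[OF g] by (intro compact_continuous_image) auto
  then obtain M where M: "M > 0" "\<And>t. t \<in> {c..d} \<Longrightarrow> norm (g t) \<le> M"
    using bounded_pos[of "g ` {c..d}"] compact_imp_bounded by blast
  show ?thesis
    unfolding abs_continuous_on_iff
  proof (intro allI impI)
    fix \<epsilon> :: real assume \<epsilon>: "0 < \<epsilon>"
    obtain \<delta> where \<delta>: "0 < \<delta>"
      and small: "\<And>D. D \<in> interval_families UNIV \<Longrightarrow> (\<Sum>(a, b)\<in>D. b - a) < \<delta> \<Longrightarrow> variation_sum g D < \<epsilon> / 2"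
      using abs_continuous_onE[OF g half_gt_zero[OF \<epsilon>]] by blast
    define \<eta> where "\<eta> = \<epsilon> / (2 * (M * K + 1))"
    have cancel: "r * (\<epsilon> / (2 * r)) = \<epsilon> / 2" if "0 < r" for r
      using that by simp
    have MK: "0 < M * K + 1"
      using M K by (simp add: add_nonneg_pos)
    have \<eta>: "0 < \<eta>"
      using \<epsilon> MK by (simp add: \<eta>_def)
    show "\<exists>\<delta>>0. \<forall>D\<in>interval_families {c..d}.
        (\<Sum>(a, b)\<in>D. b - a) < \<delta> \<longrightarrow> variation_sum (\<lambda>t. g t * w t) D < \<epsilon>"
    proof (intro exI[of _ "min \<delta> \<eta>"] conjI ballI impI)
      fix D assume fam: "D \<in> interval_families {c..d}" and len: "(\<Sum>(a, b)\<in>D. b - a) < min \<delta> \<eta>"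
      have D: "a < b" "{a..b} \<subseteq> {c..d}" if "(a, b) \<in> D" for a b
        using fam that unfolding interval_families_def by blast+
      have fam': "D \<in> interval_families UNIV"
        using fam unfolding interval_families_def by auto
      have "(\<Sum>(a, b)\<in>D. norm (g b * w b - g a * w a)) \<le> (\<Sum>(a, b)\<in>D. norm (g b - g a) + M * K * (b - a))"
      proof (rule sum_mono, clarify)
        fix a b assume "(a, b) \<in> D"
        then have ab: "a < b" "{a..b} \<subseteq> {c..d}"
          using D by auto
        have "g b * w b - g a * w a = (g b - g a) * w b + g a * (w b - w a)"
          by (simp add: algebra_simps)
        also have "norm \<dots> \<le> norm (g b - g a) * norm (w b) + norm (g a) * norm (w b - w a)"
          by (metis norm_mult norm_triangle_ineq)
        also have "\<dots> \<le> norm (g b - g a) * 1 + M * (K * (b - a))"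
          using w(1)[of b] w(2)[of b a] M ab by (intro add_mono mult_mono) auto
        finally show "norm (g b * w b - g a * w a) \<le> norm (g b - g a) + M * K * (b - a)"
          by (simp add: mult.assoc)
      qed
      also have "\<dots> = (\<Sum>(a, b)\<in>D. norm (g b - g a)) + M * K * (\<Sum>(a, b)\<in>D. b - a)"
        by (simp add: sum.distrib sum_distrib_left case_prod_beta)
      also have "\<dots> < \<epsilon> / 2 + \<epsilon> / 2"
      proof (rule add_less_le_mono)
        show "(\<Sum>(a, b)\<in>D. norm (g b - g a)) < \<epsilon> / 2"
          using small[OF fam'] len by (simp add: variation_sum_def)
        have "M * K * (\<Sum>(a, b)\<in>D. b - a) \<le> (M * K + 1) * \<eta>"
        proof (rule mult_mono)
          show "0 \<le> (\<Sum>(a, b)\<in>D. b - a)"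
            using D by (intro sum_nonneg) (auto simp: less_imp_le)
        qed (use len MK in auto)
        also have "\<dots> = \<epsilon> / 2"
          unfolding \<eta>_def using MK by (rule cancel)
        finally show "M * K * (\<Sum>(a, b)\<in>D. b - a) \<le> \<epsilon> / 2" .
      qed
      finally show "variation_sum (\<lambda>t. g t * w t) D < \<epsilon>"
        by (simp add: variation_sum_def)
    qed (use \<delta> \<eta> in auto)
  qed
qed

lemma norm_exp_i_diff_le: "norm (exp (\<i> * of_real s) - exp (\<i> * of_real t)) \<le> \<bar>s - t\<bar>"
proof -
  have "exp (\<i> * of_real s) - exp (\<i> * of_real t) = exp (\<i> * of_real t) * (exp (\<i> * of_real (s - t)) - 1)"
    by (simp add: exp_diff algebra_simps)
  then have "norm (exp (\<i> * of_real s) - exp (\<i> * of_real t)) = norm (exp (\<i> * of_real (s - t)) - 1)"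
    by (simp add: norm_mult)
  also have "\<dots> = 2 * \<bar>sin ((s - t) / 2)\<bar>"
    by (rule dist_exp_i_1)
  also have "\<dots> \<le> \<bar>s - t\<bar>"
    using abs_sin_x_le_abs_x[of "(s - t) / 2"] by simp
  finally show ?thesis .
qed

section \<open>Integrals of directional derivatives\<close>

text \<open>
  Fubini's theorem is applied to Borel functions on the product of the Borel measures
  \<open>lborel\<close>; a Lebesgue integrable function enters through a Borel representative.
\<close>

lemma borel_representative:
  fixes f :: "'a::euclidean_space \<Rightarrow> complex"
  assumes "integrable lebesgue f"
  obtains f0 where "f0 \<in> borel_measurable borel" "AE x in lborel. f x = f0 x"
    "integrable lborel f0" "integral\<^sup>L lebesgue f = integral\<^sup>L lborel f0"
proof -
  have f: "f \<in> borel_measurable lebesgue"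
    using assms by (rule borel_measurable_integrable)
  obtain u where u: "u \<in> borel_measurable lborel" "AE x in lborel. Re (f x) = u x"
    using completion_ex_borel_measurable_real[OF measurable_compose[OF f borel_measurable_Re]] by blast
  obtain v where v: "v \<in> borel_measurable lborel" "AE x in lborel. Im (f x) = v x"
    using completion_ex_borel_measurable_real[OF measurable_compose[OF f borel_measurable_Im]] by blast
  define f0 where "f0 = (\<lambda>x. complex_of_real (u x) + \<i> * complex_of_real (v x))"
  have f0: "f0 \<in> borel_measurable lborel"
    unfolding f0_def using u v by (intro borel_measurable_add borel_measurable_times measurable_compose[OF _ borel_measurable_of_real]) auto
  have ae: "AE x in lborel. f x = f0 x"
    using u(2) v(2) by eventually_elim (simp add: f0_def complex_eq_iff)
  have ae': "AE x in lebesgue. f x = f0 x"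
    using ae by (rule AE_completion)
  have f0': "f0 \<in> borel_measurable lebesgue"
    using f0 by (rule measurable_completion)
  have "integrable lebesgue f0"
    using assms integrable_cong_AE[OF f f0' ae'] by simp
  then have "integrable lborel f0"
    using integrable_completion[OF f0] by simp
  moreover have "integral\<^sup>L lebesgue f = integral\<^sup>L lborel f0"
    using integral_cong_AE[OF f f0' ae'] integral_completion[OF f0] by simp
  ultimately show thesis
    using f0 ae by (intro that[of f0]) auto
qed

lemma nn_integral_translate:
  fixes f :: "'a::euclidean_space \<Rightarrow> ennreal"
  assumes [measurable]: "f \<in> borel_measurable borel"
  shows "(\<integral>\<^sup>+y. f (y + v) \<partial>lborel) = (\<integral>\<^sup>+y. f y \<partial>lborel)"
proof -
  have "(\<integral>\<^sup>+y. f y \<partial>lborel) = (\<integral>\<^sup>+y. f y \<partial>distr lborel borel ((+) v))"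
    by (simp add: lborel_distr_plus)
  also have "\<dots> = (\<integral>\<^sup>+y. f (y + v) \<partial>lborel)"
    by (subst nn_integral_distr) (auto simp: add.commute)
  finally show ?thesis ..
qed

lemma
  fixes f :: "'a::euclidean_space \<Rightarrow> complex"
  assumes [measurable]: "f \<in> borel_measurable borel"
  shows integral_translate: "(\<integral>y. f (y + v) \<partial>lborel) = (\<integral>y. f y \<partial>lborel)"
    and integrable_translate: "integrable lborel f \<Longrightarrow> integrable lborel (\<lambda>y. f (y + v))"
proof -
  have "(\<integral>y. f y \<partial>lborel) = (\<integral>y. f y \<partial>distr lborel borel ((+) v))"
    by (simp add: lborel_distr_plus)
  also have "\<dots> = (\<integral>y. f (y + v) \<partial>lborel)"
    by (subst integral_distr) (auto simp: add.commute)
  finally show "(\<integral>y. f (y + v) \<partial>lborel) = (\<integral>y. f y \<partial>lborel)" ..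
  assume "integrable lborel f"
  then have "integrable (distr lborel borel ((+) v)) f"
    by (simp add: lborel_distr_plus)
  then show "integrable lborel (\<lambda>y. f (y + v))"
    by (subst (asm) integrable_distr_eq) (auto simp: add.commute)
qed

lemma AE_translate:
  fixes v :: "'a::euclidean_space"
  assumes "AE y in lborel. P y"
  shows "AE y in lborel. P (y + v)"
proof -
  obtain N where N: "{y \<in> space lborel. \<not> P y} \<subseteq> N" "emeasure lborel N = 0" "N \<in> sets lborel"
    using assms by (rule AE_E)
  have [measurable]: "N \<in> sets borel"
    using N by simp
  have "(\<integral>\<^sup>+y. indicator N (y + v) \<partial>lborel) = (\<integral>\<^sup>+y. indicator N y \<partial>lborel)"
    by (rule nn_integral_translate) measurable
  also have "\<dots> = 0"
    using N by simp
  finally have "AE y in lborel. (indicator N (y + v) :: ennreal) = 0"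
    by (subst (asm) nn_integral_0_iff_AE) auto
  then show ?thesis
    by eventually_elim (use N(1) in \<open>auto simp: indicator_def split: if_splits\<close>)
qed

text \<open>
  This carries the passage to a Borel representative over to lines: on almost every
  parallel to \<open>e\<close>, two almost everywhere equal functions agree almost everywhere.  It is
  Fubini's theorem for the set of \<open>(y, s)\<close> such that \<open>y + s *\<^sub>R e\<close> lies in a null set, whose
  slices for fixed \<open>s\<close> are translates of that null set.
\<close>

lemma AE_line_AE:
  fixes e :: "'a::euclidean_space"
  assumes "AE y in lborel. P y"
  shows "AE y in lborel. AE s in lborel. P (y + s *\<^sub>R e)"
proof -
  obtain N where N: "{y \<in> space lborel. \<not> P y} \<subseteq> N" "emeasure lborel N = 0" "N \<in> sets lborel"
    using assms by (rule AE_E)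
  have [measurable]: "N \<in> sets borel"
    using N by simp
  have meas: "(\<lambda>(y::'a, s::real). indicator N (y + s *\<^sub>R e) :: ennreal) \<in> borel_measurable (lborel \<Otimes>\<^sub>M lborel)"
    by measurable
  have "(\<integral>\<^sup>+y. \<integral>\<^sup>+s. indicator N (y + s *\<^sub>R e) \<partial>lborel \<partial>lborel)
      = (\<integral>\<^sup>+s. \<integral>\<^sup>+y. indicator N (y + s *\<^sub>R e) \<partial>lborel \<partial>lborel)"
    using lborel_pair.Fubini'[OF meas] by simp
  also have "\<dots> = (\<integral>\<^sup>+s. \<integral>\<^sup>+y. indicator N y \<partial>(lborel :: 'a measure) \<partial>(lborel :: real measure))"
    by (intro nn_integral_cong nn_integral_translate) measurable
  also have "\<dots> = 0"
    using N by simp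
  finally have "AE y in lborel. (\<integral>\<^sup>+s. (indicator N (y + s *\<^sub>R e) :: ennreal) \<partial>lborel) = 0"
    by (subst (asm) nn_integral_0_iff_AE) (auto intro!: lborel.borel_measurable_nn_integral)
  then show ?thesis
  proof eventually_elim
    fix y :: 'a assume "(\<integral>\<^sup>+s. (indicator N (y + s *\<^sub>R e) :: ennreal) \<partial>lborel) = 0"
    then have "AE s in lborel. (indicator N (y + s *\<^sub>R e) :: ennreal) = 0"
      by (subst (asm) nn_integral_0_iff_AE) auto
    then show "AE s in lborel. P (y + s *\<^sub>R e)"
      by eventually_elim (use N(1) in \<open>auto simp: indicator_def split: if_splits\<close>)
  qed
qed

text \<open>
  Integrate \<open>h (y + e) - h y = (\<integral>s\<in>[0, 1]. H (y + s *\<^sub>R e))\<close> over all \<open>y\<close>.  By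
  translation invariance the left-hand side gives 0, and, after exchanging the
  integrals, the right-hand side gives the integral of \<open>H\<close>.  Translation invariance thus
  replaces the limits of \<open>h\<close> at infinity of the usual integration by parts.
\<close>

lemma integral_directional_derivative_eq_0:
  fixes h H :: "'a::euclidean_space \<Rightarrow> complex"
  assumes h: "integrable lebesgue h" and H: "integrable lebesgue H"
    and FTC: "\<And>y. ((\<lambda>s. H (y + s *\<^sub>R e)) has_integral h (y + e) - h y) {0..1}"
  shows "integral\<^sup>L lebesgue H = 0"
proof -
  obtain h0 where h0[measurable]: "h0 \<in> borel_measurable borel" and h0_eq: "AE x in lborel. h x = h0 x"
    and h0_int: "integrable lborel h0"
    using borel_representative[OF h] by metis
  obtain H0 where H0[measurable]: "H0 \<in> borel_measurable borel" and H0_eq: "AE x in lborel. H x = H0 x"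
    and H0_int: "integrable lborel H0" and H_H0: "integral\<^sup>L lebesgue H = integral\<^sup>L lborel H0"
    using borel_representative[OF H] by metis
  define \<Phi> where "\<Phi> = (\<lambda>s y. if s \<in> {0..1::real} then H0 (y + s *\<^sub>R e) else 0)"
  have \<Phi>[measurable]: "case_prod \<Phi> \<in> borel_measurable (lborel \<Otimes>\<^sub>M lborel)"
    unfolding \<Phi>_def by measurable
  have \<Phi>_int: "integrable (lborel \<Otimes>\<^sub>M lborel) (case_prod \<Phi>)"
  proof (rule integrableI_bounded[OF \<Phi>])
    have "(\<integral>\<^sup>+z. ennreal (norm (case_prod \<Phi> z)) \<partial>(lborel \<Otimes>\<^sub>M lborel)) =
        (\<integral>\<^sup>+s. \<integral>\<^sup>+y. ennreal (norm (\<Phi> s y)) \<partial>lborel \<partial>lborel)"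
      by (subst lborel.nn_integral_fst[symmetric]) auto
    also have "\<dots> = (\<integral>\<^sup>+s. indicator {0..1::real} s * (\<integral>\<^sup>+y. ennreal (norm (H0 y)) \<partial>lborel) \<partial>lborel)"
    proof (rule nn_integral_cong)
      fix s :: real
      show "(\<integral>\<^sup>+y. ennreal (norm (\<Phi> s y)) \<partial>lborel) = indicator {0..1} s * (\<integral>\<^sup>+y. ennreal (norm (H0 y)) \<partial>lborel)"
        using nn_integral_translate[of "\<lambda>y. ennreal (norm (H0 y))" "s *\<^sub>R e"]
        by (auto simp: \<Phi>_def indicator_def)
    qed
    also have "\<dots> = (\<integral>\<^sup>+y. ennreal (norm (H0 y)) \<partial>lborel)"
      by (simp add: nn_integral_multc)
    also have "\<dots> < \<infinity>"
      using H0_int by (simp add: integrable_iff_bounded)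
    finally show "(\<integral>\<^sup>+z. ennreal (norm (case_prod \<Phi> z)) \<partial>(lborel \<Otimes>\<^sub>M lborel)) < \<infinity>" .
  qed
  have "(\<integral>y. (\<integral>s. \<Phi> s y \<partial>lborel) \<partial>lborel) = (\<integral>s. (\<integral>y. \<Phi> s y \<partial>lborel) \<partial>lborel)"
    by (rule lborel_pair.Fubini_integral[OF \<Phi>_int])
  also have "\<dots> = (\<integral>s. indicator {0..1::real} s *\<^sub>R (\<integral>y. H0 y \<partial>lborel) \<partial>lborel)"
  proof (intro Bochner_Integration.integral_cong refl)
    fix s :: real
    show "(\<integral>y. \<Phi> s y \<partial>lborel) = indicator {0..1} s *\<^sub>R (\<integral>y. H0 y \<partial>lborel)"
      using integral_translate[OF H0, of "s *\<^sub>R e"] by (auto simp: \<Phi>_def indicator_def)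
  qed
  also have "\<dots> = (\<integral>y. H0 y \<partial>lborel)"
    by simp
  finally have swap: "(\<integral>y. (\<integral>s. \<Phi> s y \<partial>lborel) \<partial>lborel) = (\<integral>y. H0 y \<partial>lborel)" .
  have "AE y in lborel. (\<integral>s. \<Phi> s y \<partial>lborel) = h0 (y + e) - h0 y"
    using h0_eq AE_translate[OF h0_eq, of e] AE_line_AE[OF H0_eq, of e] lborel_pair.AE_integrable_snd[OF \<Phi>_int]
  proof eventually_elim
    case (elim y)
    have "AE s in lborel. s \<in> {0..1} \<longrightarrow> H (y + s *\<^sub>R e) = H0 (y + s *\<^sub>R e)"
      using elim(3) by eventually_elim simp
    then have "((\<lambda>s. H0 (y + s *\<^sub>R e)) has_integral h (y + e) - h y) {0..1}"
      using FTC[of y] by (simp only: has_integral_AE)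
    then have "((\<lambda>s. \<Phi> s y) has_integral h (y + e) - h y) UNIV"
      unfolding \<Phi>_def by (subst has_integral_restrict_UNIV)
    moreover have "((\<lambda>s. \<Phi> s y) has_integral (\<integral>s. \<Phi> s y \<partial>lborel)) UNIV"
      using elim(4) by (rule has_integral_integral_lborel)
    ultimately show ?case
      using elim(1,2) has_integral_unique by metis
  qed
  then have "(\<integral>y. (\<integral>s. \<Phi> s y \<partial>lborel) \<partial>lborel) = (\<integral>y. h0 (y + e) - h0 y \<partial>lborel)"
    using lborel_pair.integrable_snd[OF \<Phi>_int] by (intro integral_cong_AE) auto
  also have "\<dots> = (\<integral>y. h0 (y + e) \<partial>lborel) - (\<integral>y. h0 y \<partial>lborel)"
    by (rule Bochner_Integration.integral_diff[OF integrable_translate[OF h0 h0_int] h0_int])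
  also have "\<dots> = 0"
    by (simp add: integral_translate)
  finally show ?thesis
    using swap H_H0 by simp
qed

section \<open>The Fourier integral of a partial derivative\<close>

lemma replace_coord_eq:
  "replace_coord y k (s + y $ k) = y + s *\<^sub>R axis k 1"
  "replace_coord (y + s *\<^sub>R axis k 1) k u = replace_coord y k u"
  by (auto simp: replace_coord_def vec_eq_iff axis_def)

text \<open>
  The integrand is the derivative along a line of the product of \<open>g\<close> with the character
  \<open>y \<mapsto> exp (- \<i> * (y \<bullet> \<xi>))\<close>.  On the line, the product remains absolutely continuous over a
  bounded interval, because there \<open>g\<close> is bounded and the character is Lipschitz.
\<close>

lemma modulated_partial_derivative_has_integral:
  fixes g :: "real ^ 'n \<Rightarrow> complex"
  assumes AC: "abs_continuous_in_coord k g"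
  shows "((\<lambda>s. (partial_derivative k g (y + s *\<^sub>R axis k 1) - \<i> * of_real (\<xi> $ k) * g (y + s *\<^sub>R axis k 1)) *
             exp (- \<i> * of_real ((y + s *\<^sub>R axis k 1) \<bullet> \<xi>)))
          has_integral
            g (y + axis k 1) * exp (- \<i> * of_real ((y + axis k 1) \<bullet> \<xi>)) - g y * exp (- \<i> * of_real (y \<bullet> \<xi>))) {0..1}"
proof -
  \<comment> \<open>The line is parametrised by its \<open>k\<close>th coordinate \<open>u = c + s\<close>, as in the hypothesis on \<open>g\<close>;
    \<open>p - u * q\<close> is the phase of the character at parameter \<open>u\<close>.\<close>
  define c q p where "c = y $ k" and "q = \<xi> $ k" and "p = c * q - y \<bullet> \<xi>"
  define \<psi> where "\<psi> = (\<lambda>u. g (replace_coord y k u))"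
  define w where "w = (\<lambda>u. exp (\<i> * of_real (p - u * q)))"
  define D where "D = (\<lambda>u. (vector_derivative \<psi> (at u) - \<i> * of_real q * \<psi> u) * w u)"
  have \<psi>: "abs_continuous_on UNIV \<psi>"
    using AC by (simp add: abs_continuous_in_coord_def \<psi>_def)
  have w_Lipschitz: "norm (w t - w s) \<le> \<bar>q\<bar> * \<bar>t - s\<bar>" for s t
  proof -
    have "norm (w t - w s) \<le> \<bar>(p - t * q) - (p - s * q)\<bar>"
      unfolding w_def by (rule norm_exp_i_diff_le)
    also have "(p - t * q) - (p - s * q) = - (q * (t - s))"
      by (simp add: algebra_simps)
    finally show ?thesis
      by (simp add: abs_mult)
  qed
  have w_deriv: "(w has_vector_derivative - \<i> * of_real q * w u) (at u within S)" for u S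
  proof -
    have "((\<lambda>z. exp (\<i> * (of_real p - z * of_real q))) has_field_derivative
            - \<i> * of_real q * exp (\<i> * (of_real p - of_real u * of_real q))) (at (of_real u))"
      by (auto intro!: derivative_eq_intros)
    from has_vector_derivative_real_field[OF this] show ?thesis
      by (simp add: w_def)
  qed
  have "(D has_integral \<psi> (c + 1) * w (c + 1) - \<psi> c * w c) {c..c + 1}"
  proof (rule abs_continuous_FTC)
    show "abs_continuous_on {c..c + 1} (\<lambda>u. \<psi> u * w u)"
      by (rule abs_continuous_mult_Lipschitz[OF \<psi> _ w_Lipschitz]) (simp add: w_def)
    show "negligible {u. \<not> \<psi> differentiable (at u)}"
      by (rule abs_continuous_differentiable_ae[OF \<psi>])
    fix u assume "u \<in> {c..c + 1} - {u. \<not> \<psi> differentiable (at u)}"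
    then have "(\<psi> has_vector_derivative vector_derivative \<psi> (at u)) (at u)"
      by (simp add: vector_derivative_works)
    then have "(\<psi> has_vector_derivative vector_derivative \<psi> (at u)) (at u within {c..c + 1})"
      by (rule has_vector_derivative_at_within)
    from has_vector_derivative_mult[OF this w_deriv]
    show "((\<lambda>u. \<psi> u * w u) has_vector_derivative D u) (at u within {c..c + 1})"
      by (simp add: D_def algebra_simps)
  qed simp
  then have shifted: "((\<lambda>s. D (s + c)) has_integral \<psi> (c + 1) * w (c + 1) - \<psi> c * w c) {0..1}"
    using has_integral_shift_real_ivl[of D _ c "c + 1" c] by simp
  have \<psi>_line: "\<psi> (s + c) = g (y + s *\<^sub>R axis k 1)" for s
    by (simp add: \<psi>_def c_def replace_coord_eq)
  have w_line: "w (s + c) = exp (- \<i> * of_real ((y + s *\<^sub>R axis k 1) \<bullet> \<xi>))" for s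
    by (simp add: w_def p_def q_def inner_add_left inner_axis' algebra_simps)
  have D_line: "D (s + c) = (partial_derivative k g (y + s *\<^sub>R axis k 1) - \<i> * of_real (\<xi> $ k) * g (y + s *\<^sub>R axis k 1)) *
             exp (- \<i> * of_real ((y + s *\<^sub>R axis k 1) \<bullet> \<xi>))" for s
  proof -
    have "partial_derivative k g (y + s *\<^sub>R axis k 1) = vector_derivative \<psi> (at (s + c))"
      by (simp add: partial_derivative_def replace_coord_eq \<psi>_def c_def add.commute)
    then show ?thesis
      by (simp only: D_def \<psi>_line w_line q_def)
  qed
  show ?thesis
    using shifted \<psi>_line[of 0] \<psi>_line[of 1] w_line[of 0] w_line[of 1]
    by (simp add: D_line add.commute[of c])
qed

lemma integrable_mult_unimodular:
  fixes F u :: "'a::euclidean_space \<Rightarrow> complex"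
  assumes F: "integrable lebesgue F" and u: "continuous_on UNIV u" "\<And>y. norm (u y) = 1"
  shows "integrable lebesgue (\<lambda>y. F y * u y)"
proof (rule Bochner_Integration.integrable_bound[OF F])
  have "u \<in> borel_measurable lebesgue"
    using borel_measurable_continuous_onI[OF u(1)] by (intro measurable_completion) simp
  then show "(\<lambda>y. F y * u y) \<in> borel_measurable lebesgue"
    using borel_measurable_integrable[OF F] by (intro borel_measurable_times)
qed (simp add: norm_mult u)

lemma norm_chirp: "norm (chirp \<alpha> y) = 1"
proof -
  have "\<i> / 2 * complex_of_real r = \<i> * of_real (r / 2)" for r
    by simp
  then show ?thesis
    unfolding chirp_def by (simp only: norm_exp_i_times)
qed

lemma continuous_chirp: "continuous_on UNIV (chirp \<alpha>)"
  unfolding chirp_def by (intro continuous_intros)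

theorem lemma4p1:
  fixes \<alpha> :: "real ^ 'n" and k :: 'n and f :: "real ^ 'n \<Rightarrow> complex" and x :: "real ^ 'n"
  assumes "\<And>j. \<alpha> $ j \<notin> range (\<lambda>m::int. pi * of_int m)"
    and "integrable lebesgue f"
    and "abs_continuous_in_coord k (\<lambda>y. chirp \<alpha> y * f y)"
    and "integrable lebesgue
           (\<lambda>y. chirp (- \<alpha>) y * partial_derivative k (\<lambda>z. chirp \<alpha> z * f z) y)"
  shows "frft \<alpha> (\<lambda>y. chirp (- \<alpha>) y * partial_derivative k (\<lambda>z. chirp \<alpha> z * f z) y) x
         = \<i> * of_real (x $ k * csc (\<alpha> $ k)) * frft \<alpha> f x"
proof -
  define g where "g = (\<lambda>y. chirp \<alpha> y * f y)"
  define \<xi> where "\<xi> = (\<chi> j. x $ j * csc (\<alpha> $ j))"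
  define E where "E = (\<lambda>y :: real ^ 'n. exp (- \<i> * complex_of_real (y \<bullet> \<xi>)))"
  define G where "G = (\<lambda>y. chirp (- \<alpha>) y * partial_derivative k g y)"
  define I where "I = (\<lambda>F. LINT y|lebesgue. F y * chirp \<alpha> y * E y)"
  have E: "exp (- \<i> * of_real (\<Sum>j\<in>UNIV. y $ j * x $ j * csc (\<alpha> $ j))) = E y" for y
    by (simp add: E_def \<xi>_def inner_vec_def mult.assoc)
  have norm_E: "norm (E y) = 1" for y
    using norm_exp_i_times[of "- (y \<bullet> \<xi>)"] by (simp add: E_def)
  have cont_E: "continuous_on UNIV E"
    unfolding E_def by (intro continuous_intros)
  have mod: "integrable lebesgue (\<lambda>y. F y * chirp \<alpha> y * E y)" if "integrable lebesgue F" for F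
    using that by (intro integrable_mult_unimodular continuous_chirp cont_E norm_chirp norm_E)
  have f_int: "integrable lebesgue (\<lambda>y. g y * E y)"
    using mod[OF assms(2)] by (simp add: g_def mult.commute[of "chirp _ _"])
  \<comment> \<open>The two chirps cancel, so the transform of \<open>G\<close> is the Fourier integral of the partial
    derivative of \<open>g\<close>.\<close>
  have G_eq: "G y * chirp \<alpha> y * E y = partial_derivative k g y * E y" for y
  proof -
    have "chirp \<alpha> y \<noteq> 0"
      by (simp add: chirp_def)
    then show ?thesis
      by (simp add: G_def chirp_uminus)
  qed
  have G_int: "integrable lebesgue (\<lambda>y. partial_derivative k g y * E y)"
    using mod[of G] assms(4) by (simp add: G_eq) (simp add: G_def g_def)
  \<comment> \<open>Where \<open>g\<close> has a \<open>k\<close>th partial derivative, \<open>H\<close> is that of \<open>\<lambda>y. g y * E y\<close>; the vanishing of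
    its integral is the claim.\<close>
  define H where "H = (\<lambda>y. (partial_derivative k g y - \<i> * of_real (\<xi> $ k) * g y) * E y)"
  have H_eq: "H y = partial_derivative k g y * E y - \<i> * of_real (\<xi> $ k) * (g y * E y)" for y
    by (simp add: H_def algebra_simps)
  have scaled: "integrable lebesgue (\<lambda>y. \<i> * of_real (\<xi> $ k) * (g y * E y))"
    using f_int by (rule integrable_mult_right)
  have "integrable lebesgue H"
    unfolding H_eq using G_int scaled by (rule Bochner_Integration.integrable_diff)
  then have "integral\<^sup>L lebesgue H = 0"
  proof (rule integral_directional_derivative_eq_0[OF f_int])
    fix y
    show "((\<lambda>s. H (y + s *\<^sub>R axis k 1)) has_integral
        g (y + axis k 1) * E (y + axis k 1) - g y * E y) {0..1}"
      unfolding H_def E_def using assms(3)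
      by (intro modulated_partial_derivative_has_integral) (simp add: g_def)
  qed
  moreover have "integral\<^sup>L lebesgue H = I G - \<i> * of_real (\<xi> $ k) * I f"
    unfolding H_eq I_def G_eq Bochner_Integration.integral_diff[OF G_int scaled]
    by (simp add: g_def mult.commute[of "chirp _ _"])
  ultimately have key: "I G = \<i> * of_real (\<xi> $ k) * I f"
    by simp
  have frft: "frft \<alpha> F x = frft_const \<alpha> / of_real (sqrt (2 * pi)) ^ CARD('n) * chirp \<alpha> x * I F" for F
    unfolding frft_def E I_def ..
  have "frft \<alpha> G x = \<i> * of_real (\<xi> $ k) * frft \<alpha> f x"
    unfolding frft key by (simp only: mult_ac)
  then show ?thesis
    by (simp add: G_def g_def \<xi>_def)
qed

end
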